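(* Let $(D,\dashv,\vdash,\alpha,\beta)$ be a BiHom-associative dialgebra and let $\alpha',\beta':D\to D$ be two morphisms of BiHom-associative dialgebras such that the maps $\alpha,\alpha',\beta,\beta'$ commute pairwise. Define $x\triangleleft y:=\alpha'(x)\dashv\beta'(y)$ and $x\triangleright y:=\alpha'(x)\vdash\beta'(y)$ for $x,y\in D$. Then $(D,\triangleleft,\triangleright,\alpha\circ\alpha',\beta\circ\beta')$ is a BiHom-associative dialgebra.
   Context: All vector spaces are over a fixed field. A BiHom-associative dialgebra is a tuple $(A,\dashv,\vdash,\alpha,\beta)$ consisting of a vector space $A$, bilinear maps $\dashv,\vdash:A\times A\to A$ and linear maps $\alpha,\beta:A\to A$ such that $\alpha\circ\beta=\beta\circ\alpha$ and, for all $x,y,z\in A$: (i) $(x\dashv y)\dashv\beta(z)=\alpha(x)\dashv(y\dashv z)$; (ii) $(x\dashv y)\dashv\beta(z)=\alpha(x)\dashv(y\vdash z)$; (iii) $(x\vdash y)\dashv\beta(z)=\alpha(x)\vdash(y\dashv z)$; (iv) $(x\dashv y)\vdash\beta(z)=\alpha(x)\vdash(y\vdash z)$; (v) $(x\vdash y)\vdash\beta(z)=\alpha(x)\vdash(y\vdash z)$. A morphism from $(D,\dashv,\vdash,\alpha,\beta)$ to $(D',\dashv',\vdash',\alpha',\beta')$ is a linear map $f:D\to D'$ with $\alpha'\circ f=f\circ\alpha$, $\beta'\circ f=f\circ\beta$, $f(x\dashv y)=f(x)\dashv' f(y)$ and $f(x\vdash y)=f(x)\vdash' f(y)$ for all $x,y\in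 D$. *)

theory Defs
  imports Complex_Main
begin

text \<open>
  The underlying vector space is the whole type \<open>'v\<close> over an arbitrary field \<open>'k\<close>, with
  scalar multiplication \<open>scale\<close>.  The structure maps \<open>\<alpha>\<close> and \<open>\<beta>\<close> are only assumed to be
  linear and to commute; they are not required to be multiplicative.
\<close>

locale bihom_dialgebra = vector_space scale
  for scale :: "'k::field \<Rightarrow> 'v::ab_group_add \<Rightarrow> 'v" +
  fixes dleft :: "'v \<Rightarrow> 'v \<Rightarrow> 'v" (infixl \<open>\<stileturn>\<close> 70)
    and dright :: "'v \<Rightarrow> 'v \<Rightarrow> 'v" (infixl \<open>\<turnstile>\<close> 70)
    and \<alpha> :: "'v \<Rightarrow> 'v"
    and \<beta> :: "'v \<Rightarrow> 'v"
  assumes dleft_linear_1: "Vector_Spaces.linear scale scale (\<lambda>x. x \<stileturn> y)"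
    and dleft_linear_2: "Vector_Spaces.linear scale scale (\<lambda>y. x \<stileturn> y)"
    and dright_linear_1: "Vector_Spaces.linear scale scale (\<lambda>x. x \<turnstile> y)"
    and dright_linear_2: "Vector_Spaces.linear scale scale (\<lambda>y. x \<turnstile> y)"
    and alpha_linear: "Vector_Spaces.linear scale scale \<alpha>"
    and beta_linear: "Vector_Spaces.linear scale scale \<beta>"
    and alpha_beta_commute: "\<alpha> \<circ> \<beta> = \<beta> \<circ> \<alpha>"
    and dleft_dleft: "(x \<stileturn> y) \<stileturn> \<beta> z = \<alpha> x \<stileturn> (y \<stileturn> z)"
    and dleft_dleft': "(x \<stileturn> y) \<stileturn> \<beta> z = \<alpha> x \<stileturn> (y \<turnstile> z)"
    and dright_dleft: "(x \<turnstile> y) \<stileturn> \<beta> z = \<alpha> x \<turnstile> (y \<stileturn> z)"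
    and dleft_dright: "(x \<stileturn> y) \<turnstile> \<beta> z = \<alpha> x \<turnstile> (y \<turnstile> z)"
    and dright_dright: "(x \<turnstile> y) \<turnstile> \<beta> z = \<alpha> x \<turnstile> (y \<turnstile> z)"

locale bihom_dialgebra_morphism =
  D1: bihom_dialgebra scale1 dleft1 dright1 \<alpha>1 \<beta>1 +
  D2: bihom_dialgebra scale2 dleft2 dright2 \<alpha>2 \<beta>2
  for scale1 :: "'k::field \<Rightarrow> 'v::ab_group_add \<Rightarrow> 'v"
    and dleft1 (infixl \<open>\<stileturn>\<^sub>1\<close> 70) and dright1 (infixl \<open>\<turnstile>\<^sub>1\<close> 70) and \<alpha>1 \<beta>1
    and scale2 :: "'k::field \<Rightarrow> 'w::ab_group_add \<Rightarrow> 'w"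
    and dleft2 (infixl \<open>\<stileturn>\<^sub>2\<close> 70) and dright2 (infixl \<open>\<turnstile>\<^sub>2\<close> 70) and \<alpha>2 \<beta>2 +
  fixes f :: "'v \<Rightarrow> 'w"
  assumes linear: "Vector_Spaces.linear scale1 scale2 f"
    and alpha_commute: "\<alpha>2 \<circ> f = f \<circ> \<alpha>1"
    and beta_commute: "\<beta>2 \<circ> f = f \<circ> \<beta>1"
    and map_dleft: "f (x \<stileturn>\<^sub>1 y) = f x \<stileturn>\<^sub>2 f y"
    and map_dright: "f (x \<turnstile>\<^sub>1 y) = f x \<turnstile>\<^sub>2 f y"

end

theory Submission
  imports Defs
begin

text \<open>
  Write \<open>\<star>\<close> and \<open>\<diamond>\<close> for either of the two products, chosen independently in each
  line below.  Since \<open>\<alpha>'\<close> and \<open>\<beta>'\<close> are multiplicative and the four maps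
  commute, the two sides of each twisted axiom expand to

    \<open>\<alpha>' (\<alpha>' x \<star> \<beta>' y) \<diamond> \<beta>' (\<beta> (\<beta>' z)) = (\<alpha>' (\<alpha>' x) \<star> \<alpha>' (\<beta>' y)) \<diamond> \<beta> (\<beta>' (\<beta>' z))\<close>,

    \<open>\<alpha>' (\<alpha> (\<alpha>' x)) \<star> \<beta>' (\<alpha>' y \<diamond> \<beta>' z) = \<alpha> (\<alpha>' (\<alpha>' x)) \<star> (\<alpha>' (\<beta>' y) \<diamond> \<beta>' (\<beta>' z))\<close>.

  So every twisted axiom is the original axiom with the same pattern of products, evaluated at
  \<open>\<alpha>' (\<alpha>' x)\<close>, \<open>\<alpha>' (\<beta>' y)\<close> and \<open>\<beta>' (\<beta>' z)\<close>.
  Bilinearity of the new products and linearity of the new structure maps hold because linear maps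
  are closed under composition.
\<close>

theorem theorem2p6:
  fixes scale :: "'k::field \<Rightarrow> 'v::ab_group_add \<Rightarrow> 'v"
    and dleft :: "'v \<Rightarrow> 'v \<Rightarrow> 'v" (infixl \<open>\<stileturn>\<close> 70)
    and dright :: "'v \<Rightarrow> 'v \<Rightarrow> 'v" (infixl \<open>\<turnstile>\<close> 70)
    and \<alpha> \<beta> \<alpha>' \<beta>' :: "'v \<Rightarrow> 'v"
  assumes "bihom_dialgebra scale (\<stileturn>) (\<turnstile>) \<alpha> \<beta>"
    and "bihom_dialgebra_morphism scale (\<stileturn>) (\<turnstile>) \<alpha> \<beta> scale (\<stileturn>) (\<turnstile>) \<alpha> \<beta> \<alpha>'"
    and "bihom_dialgebra_morphism scale (\<stileturn>) (\<turnstile>) \<alpha> \<beta> scale (\<stileturn>) (\<turnstile>) \<alpha> \<beta> \<beta>'"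
    and "\<alpha> \<circ> \<alpha>' = \<alpha>' \<circ> \<alpha>" and "\<alpha> \<circ> \<beta> = \<beta> \<circ> \<alpha>" and "\<alpha> \<circ> \<beta>' = \<beta>' \<circ> \<alpha>"
    and "\<alpha>' \<circ> \<beta> = \<beta> \<circ> \<alpha>'" and "\<alpha>' \<circ> \<beta>' = \<beta>' \<circ> \<alpha>'" and "\<beta> \<circ> \<beta>' = \<beta>' \<circ> \<beta>"
  shows "bihom_dialgebra scale (\<lambda>x y. \<alpha>' x \<stileturn> \<beta>' y) (\<lambda>x y. \<alpha>' x \<turnstile> \<beta>' y) (\<alpha> \<circ> \<alpha>') (\<beta> \<circ> \<beta>')"
proof -
  interpret D: bihom_dialgebra scale "(\<stileturn>)" "(\<turnstile>)" \<alpha> \<beta>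
    by fact
  interpret A: bihom_dialgebra_morphism scale "(\<stileturn>)" "(\<turnstile>)" \<alpha> \<beta> scale "(\<stileturn>)" "(\<turnstile>)" \<alpha> \<beta> \<alpha>'
    by fact
  interpret B: bihom_dialgebra_morphism scale "(\<stileturn>)" "(\<turnstile>)" \<alpha> \<beta> scale "(\<stileturn>)" "(\<turnstile>)" \<alpha> \<beta> \<beta>'
    by fact
  \<comment> \<open>Oriented as rewrite rules, these move \<open>\<alpha>\<close> and \<open>\<beta>\<close> outwards and put
    \<open>\<alpha>'\<close> before \<open>\<beta>'\<close>, which is the normal form in which the original axioms apply.\<close>
  have comm: "\<alpha>' (\<alpha> x) = \<alpha> (\<alpha>' x)" "\<beta>' (\<beta> x) = \<beta> (\<beta>' x)" "\<beta>' (\<alpha>' x) = \<alpha>' (\<beta>' x)" for x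
    using assms(4,8,9) by (simp_all add: fun_eq_iff)
  note expand = comm A.map_dleft A.map_dright B.map_dleft B.map_dright
  show ?thesis
  proof (intro bihom_dialgebra.intro bihom_dialgebra_axioms.intro)
    show "vector_space scale"
      by (rule D.vector_space_axioms)
    show "Vector_Spaces.linear scale scale (\<lambda>x. \<alpha>' x \<stileturn> \<beta>' y)" for y
      using Vector_Spaces.linear_compose[OF A.linear D.dleft_linear_1] by (simp add: o_def)
    show "Vector_Spaces.linear scale scale (\<lambda>y. \<alpha>' x \<stileturn> \<beta>' y)" for x
      using Vector_Spaces.linear_compose[OF B.linear D.dleft_linear_2] by (simp add: o_def)
    show "Vector_Spaces.linear scale scale (\<lambda>x. \<alpha>' x \<turnstile> \<beta>' y)" for y
      using Vector_Spaces.linear_compose[OF A.linear D.dright_linear_1] by (simp add: o_def)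
    show "Vector_Spaces.linear scale scale (\<lambda>y. \<alpha>' x \<turnstile> \<beta>' y)" for x
      using Vector_Spaces.linear_compose[OF B.linear D.dright_linear_2] by (simp add: o_def)
    show "Vector_Spaces.linear scale scale (\<alpha> \<circ> \<alpha>')"
      by (rule Vector_Spaces.linear_compose[OF A.linear D.alpha_linear])
    show "Vector_Spaces.linear scale scale (\<beta> \<circ> \<beta>')"
      by (rule Vector_Spaces.linear_compose[OF B.linear D.beta_linear])
    show "(\<alpha> \<circ> \<alpha>') \<circ> (\<beta> \<circ> \<beta>') = (\<beta> \<circ> \<beta>') \<circ> (\<alpha> \<circ> \<alpha>')"
      using assms(5-8) by (simp add: fun_eq_iff)
  next
    fix x y z
    show "\<alpha>' (\<alpha>' x \<stileturn> \<beta>' y) \<stileturn> \<beta>' ((\<beta> \<circ> \<beta>') z) = \<alpha>' ((\<alpha> \<circ> \<alpha>') x) \<stileturn> \<beta>' (\<alpha>' y \<stileturn> \<beta>' z)"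
      by (simp add: expand D.dleft_dleft)
    show "\<alpha>' (\<alpha>' x \<stileturn> \<beta>' y) \<stileturn> \<beta>' ((\<beta> \<circ> \<beta>') z) = \<alpha>' ((\<alpha> \<circ> \<alpha>') x) \<stileturn> \<beta>' (\<alpha>' y \<turnstile> \<beta>' z)"
      by (simp add: expand D.dleft_dleft')
    show "\<alpha>' (\<alpha>' x \<turnstile> \<beta>' y) \<stileturn> \<beta>' ((\<beta> \<circ> \<beta>') z) = \<alpha>' ((\<alpha> \<circ> \<alpha>') x) \<turnstile> \<beta>' (\<alpha>' y \<stileturn> \<beta>' z)"
      by (simp add: expand D.dright_dleft)
    show "\<alpha>' (\<alpha>' x \<stileturn> \<beta>' y) \<turnstile> \<beta>' ((\<beta> \<circ> \<beta>') z) = \<alpha>' ((\<alpha> \<circ> \<alpha>') x) \<turnstile> \<beta>' (\<alpha>' y \<turnstile> \<beta>' z)"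
      by (simp add: expand D.dleft_dright)
    show "\<alpha>' (\<alpha>' x \<turnstile> \<beta>' y) \<turnstile> \<beta>' ((\<beta> \<circ> \<beta>') z) = \<alpha>' ((\<alpha> \<circ> \<alpha>') x) \<turnstile> \<beta>' (\<alpha>' y \<turnstile> \<beta>' z)"
      by (simp add: expand D.dright_dright)
  qed
qed

end
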